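(* For any $\nu>0$ we have $\mathbb{B}_H(\nu)\subsetneq\mathcal{B}^*_H(\nu/2)$. In particular, $\mathbb{B}(\nu)\subsetneq\mathcal{B}(\nu/2)$. Moreover, these two inclusions are best possible: for every $0<\varepsilon<\nu/2$ one has $\mathbb{B}_H(\nu)\not\subseteq\mathcal{B}^*_H(\varepsilon)$ and $\mathbb{B}(\nu)\not\subseteq\mathcal{B}(\varepsilon)$.
   Context: $\mathbb{D}$ is the open unit disk in $\mathbb{C}$. A harmonic mapping in $\mathbb{D}$ is a complex-valued $f$ with $f_{z\overline z}=0$; it decomposes as $f=h+\overline g$ with $h,g$ analytic in $\mathbb{D}$, $g(0)=0$. Its Jacobian is $J_f=|h'|^2-|g'|^2$. For $\nu>0$: $\mathcal{B}^*_H(\nu)$ is the set of harmonic mappings $f$ in $\mathbb{D}$ with $\sup_{z\in\mathbb{D}}(1-|z|^2)^\nu\sqrt{|J_f(z)|}<\infty$; $\mathcal{B}(\nu)$ is the set of analytic functions $f$ in $\mathbb{D}$ with $\sup_{z\in\mathbb{D}}(1-|z|^2)^\nu|f'(z)|<\infty$. For a locally univalent harmonic mapping $f$ in $\mathbb{D}$ (so $J_f\neq0$ in $\mathbb{D}$), the pre-Schwarzian derivative is $P_f=(\log J_f)_z=(J_f)_z/J_f$, and its norm is $\|P_f\|=\sup_{z\in\mathbb{D}}(1-|z|^2)|P_f(z)|$. $\mathbb{B}_H(\nu)$ is the set of locally univalent harmonic mappings $f$ in $\mathbb{D}$ with $\|P_f\|\le\nu$, and $\mathbb{B}(\nu)$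 is the subset of all analytic functions in $\mathbb{B}_H(\nu)$. *)

theory Defs
  imports "HOL-Complex_Analysis.Complex_Analysis"
begin

section \<open>Wirtinger derivatives and harmonic mappings\<close>

definition dz :: "(complex \<Rightarrow> complex) \<Rightarrow> complex \<Rightarrow> complex" where
  "dz f z = (frechet_derivative f (at z) 1 - \<i> * frechet_derivative f (at z) \<i>) / 2"

definition dzbar :: "(complex \<Rightarrow> complex) \<Rightarrow> complex \<Rightarrow> complex" where
  "dzbar f z = (frechet_derivative f (at z) 1 + \<i> * frechet_derivative f (at z) \<i>) / 2"

text \<open>Differentiability here is real differentiability on \<open>\<complex> = \<real>\<^sup>2\<close>.\<close>

definition C1_on :: "complex set \<Rightarrow> (complex \<Rightarrow> complex) \<Rightarrow> bool" where
  "C1_on S f \<longleftrightarrow> (\<forall>z\<in>S. f differentiable (at z)) \<and>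
     (\<forall>v. continuous_on S (\<lambda>z. frechet_derivative f (at z) v))"

definition C2_on :: "complex set \<Rightarrow> (complex \<Rightarrow> complex) \<Rightarrow> bool" where
  "C2_on S f \<longleftrightarrow> C1_on S f \<and> (\<forall>v. C1_on S (\<lambda>z. frechet_derivative f (at z) v))"

definition harmonic_mapping_on :: "complex set \<Rightarrow> (complex \<Rightarrow> complex) \<Rightarrow> bool" where
  "harmonic_mapping_on S f \<longleftrightarrow> C2_on S f \<and> (\<forall>z\<in>S. dzbar (dz f) z = 0)"

text \<open>
  For \<open>f = h + cnj g\<close> with \<open>h\<close>, \<open>g\<close> analytic this is \<open>|h'|\<^sup>2 - |g'|\<^sup>2\<close>; see
  \<open>jacobian_decomposition\<close> below.
\<close>

definition jacobian :: "(complex \<Rightarrow> complex) \<Rightarrow> complex \<Rightarrow> real" where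
  "jacobian f z = (cmod (dz f z))\<^sup>2 - (cmod (dzbar f z))\<^sup>2"

definition locally_univalent_on :: "complex set \<Rightarrow> (complex \<Rightarrow> complex) \<Rightarrow> bool" where
  "locally_univalent_on S f \<longleftrightarrow> (\<forall>z\<in>S. \<exists>r>0. ball z r \<subseteq> S \<and> inj_on f (ball z r))"


section \<open>The pre-Schwarzian derivative and the function classes\<close>

text \<open>
  By Lewy's theorem the Jacobian of a locally univalent harmonic mapping has no zeros, so the
  quotient is a genuine one for the functions considered.
\<close>

definition pre_schwarzian :: "(complex \<Rightarrow> complex) \<Rightarrow> complex \<Rightarrow> complex" where
  "pre_schwarzian f z = dz (\<lambda>w. complex_of_real (jacobian f w)) z / complex_of_real (jacobian f z)"

text \<open>The norm is extended-real valued, since the supremum may be infinite.\<close>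

definition pre_schwarzian_norm :: "(complex \<Rightarrow> complex) \<Rightarrow> ereal" where
  "pre_schwarzian_norm f =
     (SUP z\<in>ball 0 1. ereal ((1 - (cmod z)\<^sup>2) * cmod (pre_schwarzian f z)))"

text \<open>
  A function on the unit disk is represented by a total function; membership in the
  classes below depends only on its values in the disk.
\<close>

definition B_H :: "real \<Rightarrow> (complex \<Rightarrow> complex) set" where
  "B_H \<nu> = {f. harmonic_mapping_on (ball 0 1) f \<and> locally_univalent_on (ball 0 1) f \<and>
                pre_schwarzian_norm f \<le> ereal \<nu>}"

definition B_A :: "real \<Rightarrow> (complex \<Rightarrow> complex) set" where
  "B_A \<nu> = {f \<in> B_H \<nu>. f holomorphic_on ball 0 1}"

definition Bloch_star_H :: "real \<Rightarrow> (complex \<Rightarrow> complex) set" where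
  "Bloch_star_H \<nu> = {f. harmonic_mapping_on (ball 0 1) f \<and>
     bdd_above ((\<lambda>z. (1 - (cmod z)\<^sup>2) powr \<nu> * sqrt \<bar>jacobian f z\<bar>) ` ball 0 1)}"

definition Bloch :: "real \<Rightarrow> (complex \<Rightarrow> complex) set" where
  "Bloch \<nu> = {f. f holomorphic_on ball 0 1 \<and>
     bdd_above ((\<lambda>z. (1 - (cmod z)\<^sup>2) powr \<nu> * cmod (deriv f z)) ` ball 0 1)}"


section \<open>The canonical decomposition\<close>

lemma frechet_derivative_decomposition:
  assumes "open S" "h holomorphic_on S" "g holomorphic_on S"
    and f: "\<And>z. z \<in> S \<Longrightarrow> f z = h z + cnj (g z)" and z: "z \<in> S"
  shows "(f has_derivative (\<lambda>v. deriv h z * v + cnj (deriv g z * v))) (at z)"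
proof -
  have h: "(h has_derivative (\<lambda>v. deriv h z * v)) (at z)"
    and g: "(g has_derivative (\<lambda>v. deriv g z * v)) (at z)"
    using assms holomorphic_derivI has_field_derivative_imp_has_derivative by blast+
  have "((\<lambda>z. h z + cnj (g z)) has_derivative (\<lambda>v. deriv h z * v + cnj (deriv g z * v))) (at z)"
    by (intro has_derivative_add h has_derivative_cnj g)
  then show ?thesis
    by (rule has_derivative_transform_within_open[OF _ \<open>open S\<close> z]) (simp add: f)
qed

lemma wirtinger_decomposition:
  assumes "open S" "h holomorphic_on S" "g holomorphic_on S"
    and "\<And>z. z \<in> S \<Longrightarrow> f z = h z + cnj (g z)" "z \<in> S"
  shows "dz f z = deriv h z" "dzbar f z = cnj (deriv g z)"
  using frechet_derivative_at[OF frechet_derivative_decomposition[OF assms], symmetric]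
  by (simp_all add: dz_def dzbar_def field_simps)

lemma jacobian_decomposition:
  assumes "open S" "h holomorphic_on S" "g holomorphic_on S"
    and "\<And>z. z \<in> S \<Longrightarrow> f z = h z + cnj (g z)" "z \<in> S"
  shows "jacobian f z = (cmod (deriv h z))\<^sup>2 - (cmod (deriv g z))\<^sup>2"
  using wirtinger_decomposition[OF assms] by (simp add: jacobian_def)

lemma C1_on_decomposition:
  assumes "open S" "h holomorphic_on S" "g holomorphic_on S"
    and "\<And>z. z \<in> S \<Longrightarrow> f z = h z + cnj (g z)"
  shows "C1_on S f"
  unfolding C1_on_def
proof (intro conjI ballI allI)
  fix z assume "z \<in> S"
  then show "f differentiable (at z)"
    using frechet_derivative_decomposition[OF assms] differentiable_def by blast
next
  fix v
  have "continuous_on S (\<lambda>z. deriv h z * v + cnj (deriv g z * v))"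
    using assms by (intro continuous_intros holomorphic_on_imp_continuous_on holomorphic_deriv)
  then show "continuous_on S (\<lambda>z. frechet_derivative f (at z) v)"
    using frechet_derivative_at[OF frechet_derivative_decomposition[OF assms], symmetric]
    by (auto cong: continuous_on_cong_simp)
qed

lemma harmonic_mapping_on_decomposition:
  assumes "open S" "h holomorphic_on S" "g holomorphic_on S"
    and "\<And>z. z \<in> S \<Longrightarrow> f z = h z + cnj (g z)"
  shows "harmonic_mapping_on S f"
proof -
  have "C1_on S (\<lambda>z. frechet_derivative f (at z) v)" for v
  proof (rule C1_on_decomposition)
    show "(\<lambda>z. deriv h z * v) holomorphic_on S" "(\<lambda>z. deriv g z * v) holomorphic_on S"
      using assms by (intro holomorphic_intros; simp)+
    show "frechet_derivative f (at z) v = deriv h z * v + cnj (deriv g z * v)" if "z \<in> S" for z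
      using frechet_derivative_at[OF frechet_derivative_decomposition[OF assms that], symmetric]
      by simp
  qed (fact \<open>open S\<close>)
  moreover have "dzbar (dz f) z = 0" if "z \<in> S" for z
  proof -
    have "dzbar (dz f) z = cnj (deriv (\<lambda>_. 0) z)"
      by (rule wirtinger_decomposition(2)[of S "deriv h"])
        (use assms that in \<open>auto intro: holomorphic_deriv simp: wirtinger_decomposition(1)[OF assms]\<close>)
    then show ?thesis by simp
  qed
  ultimately show ?thesis
    using C1_on_decomposition[OF assms] by (simp add: harmonic_mapping_on_def C2_on_def)
qed

lemma linear_complex_expand:
  fixes D :: "complex \<Rightarrow> complex"
  assumes "linear D"
  shows "D v = Re v *\<^sub>R D 1 + Im v *\<^sub>R D \<i>"
proof -
  have "v = Re v *\<^sub>R 1 + Im v *\<^sub>R \<i>"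
    by (simp add: complex_eq_iff)
  then have "D v = D (Re v *\<^sub>R 1 + Im v *\<^sub>R \<i>)"
    by (rule arg_cong)
  then show ?thesis
    by (simp only: linear_add[OF assms] linear_scale[OF assms])
qed

lemma dzbar_eq_0_imp_field_derivative:
  assumes "f differentiable (at z)" "dzbar f z = 0"
  shows "(f has_field_derivative dz f z) (at z)"
proof -
  let ?D = "frechet_derivative f (at z)"
  have D: "(f has_derivative ?D) (at z)" and lin: "linear ?D"
    using assms(1) frechet_derivative_works linear_frechet_derivative by blast+
  have 1: "\<i> * ?D \<i> = - ?D 1"
    using assms(2) by (simp add: dzbar_def add_eq_0_iff)
  then have "\<i> * (\<i> * ?D \<i>) = - (\<i> * ?D 1)" by simp
  then have 2: "?D \<i> = \<i> * ?D 1" by (simp flip: mult.assoc)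
  have "?D v = dz f z * v" for v
  proof -
    have "?D v = Re v *\<^sub>R ?D 1 + Im v *\<^sub>R ?D \<i>"
      by (rule linear_complex_expand[OF lin])
    also have "\<dots> = ?D 1 * v"
      unfolding 2 by (simp add: complex_eq_iff algebra_simps)
    also have "?D 1 = dz f z"
      unfolding dz_def 1 by simp
    finally show ?thesis .
  qed
  then have "?D = (*) (dz f z)" by auto
  with D show ?thesis by (simp add: has_field_derivative_def)
qed

lemma harmonic_mapping_obtains_decomposition:
  assumes "harmonic_mapping_on (ball 0 1) f"
  obtains h g where "h holomorphic_on ball 0 1" "g holomorphic_on ball 0 1" "g 0 = 0"
    and "\<And>z. z \<in> ball 0 1 \<Longrightarrow> f z = h z + cnj (g z)"
proof -
  let ?D = "ball 0 1 :: complex set"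
  have fd: "f differentiable (at z)" if "z \<in> ?D" for z
    using assms that by (simp add: harmonic_mapping_on_def C2_on_def C1_on_def)
  have "dz f differentiable (at z)" if "z \<in> ?D" for z
  proof -
    have "(\<lambda>z. frechet_derivative f (at z) v) differentiable (at z)" for v
      using assms that by (simp add: harmonic_mapping_on_def C2_on_def C1_on_def)
    then have "(\<lambda>z. (1/2) * (frechet_derivative f (at z) 1 - \<i> * frechet_derivative f (at z) \<i>))
        differentiable (at z)"
      by (intro differentiable_mult differentiable_diff differentiable_const)
    then show ?thesis by (simp add: dz_def[abs_def])
  qed
  then have "dz f field_differentiable (at z)" if "z \<in> ?D" for z
    using dzbar_eq_0_imp_field_derivative[of "dz f" z] assms that
    by (auto simp: harmonic_mapping_on_def field_differentiable_def)
  then have "dz f holomorphic_on ?D"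
    by (simp add: holomorphic_on_open field_differentiable_def)
  then obtain h where h: "\<And>z. z \<in> ?D \<Longrightarrow> (h has_field_derivative dz f z) (at z)"
    using holomorphic_convex_primitive'[of ?D "dz f"] by (auto simp: at_within_open_NO_MATCH)
  define k where "k z = cnj (f z - h z)" for z
  have kD: "(k has_field_derivative cnj (dzbar f z)) (at z)" if z: "z \<in> ?D" for z
  proof -
    let ?D = "frechet_derivative f (at z)"
    have D: "(f has_derivative ?D) (at z)" and lin: "linear ?D"
      using fd[OF z] frechet_derivative_works linear_frechet_derivative by blast+
    have "(k has_derivative (\<lambda>v. cnj (?D v - dz f z * v))) (at z)"
      unfolding k_def
      by (intro has_derivative_cnj has_derivative_diff D
          has_field_derivative_imp_has_derivative h z)
    moreover have "cnj (?D v - dz f z * v) = cnj (dzbar f z) * v" for v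
    proof -
      have "?D v = Re v *\<^sub>R ?D 1 + Im v *\<^sub>R ?D \<i>"
        by (rule linear_complex_expand[OF lin])
      then have "?D v - dz f z * v = dzbar f z * cnj v"
        by (simp add: dz_def dzbar_def complex_eq_iff field_simps)
      then show ?thesis by simp
    qed
    ultimately show ?thesis by (simp add: has_field_derivative_def)
  qed
  show thesis
  proof
    show "(\<lambda>z. h z + cnj (k 0)) holomorphic_on ?D"
      using h by (intro holomorphic_intros) (use holomorphic_on_open open_ball in blast)
    show "(\<lambda>z. k z - k 0) holomorphic_on ?D"
      using kD by (intro holomorphic_intros) (use holomorphic_on_open open_ball in blast)
  qed (simp_all add: k_def)
qed

end

theory Submission
  imports Defs
begin

text \<open>
  Along a radius, \<open>u(t) = J\<^sub>f(t\<zeta>)\<close> satisfies \<open>\<bar>u'\<bar> \<le> 2 \<bar>(J\<^sub>f)\<^sub>z\<bar> \<le> 2\<nu>/(1 - t\<^sup>2) \<bar>u\<bar>\<close>, so a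
  Gronwall argument gives \<open>\<bar>J\<^sub>f(z)\<bar> \<le> \<bar>J\<^sub>f(0)\<bar> ((1 + \<bar>z\<bar>)/(1 - \<bar>z\<bar>))\<^sup>\<nu>\<close>. Monotonicity is shown for
  \<open>u\<^sup>2 ((1 - t)/(1 + t))\<^sup>2\<^sup>\<nu>\<close>, whose derivative vanishes at zeros of \<open>u\<close>; hence Lewy's theorem
  is not needed. A constant function shows strictness, and the primitive of
  \<open>(1 - z) powr (-\<nu>/2)\<close>, whose pre-Schwarzian derivative is \<open>\<nu>/(2(1 - z))\<close>, shows sharpness.
\<close>

section \<open>Real differential of the Jacobian\<close>

lemma has_derivative_norm_square_holomorphic:
  assumes "(h has_field_derivative h') (at z)"
  shows "((\<lambda>w. (cmod (h w))\<^sup>2) has_derivative (\<lambda>v. 2 * Re (h' * cnj (h z) * v))) (at z)"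
proof -
  have "(h has_derivative (\<lambda>v. h' * v)) (at z)"
    using assms by (rule has_field_derivative_imp_has_derivative)
  then have "((\<lambda>w. h w \<bullet> h w) has_derivative (\<lambda>v. h z \<bullet> (h' * v) + (h' * v) \<bullet> h z)) (at z)"
    by (intro has_derivative_inner)
  moreover have "(\<lambda>v. h z \<bullet> (h' * v) + (h' * v) \<bullet> h z) = (\<lambda>v. 2 * Re (h' * cnj (h z) * v))"
    by (auto simp: inner_complex_def algebra_simps)
  ultimately show ?thesis
    by (simp add: power2_norm_eq_inner)
qed

text \<open>A real-valued \<open>u\<close> has differential \<open>2 * Re (u_z * v)\<close>, so a
  real derivative of this shape carries the Wirtinger derivative as its coefficient.\<close>

lemma dz_of_real:
  assumes "(u has_derivative (\<lambda>v. 2 * Re (a * v))) (at z)"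
  shows "dz (\<lambda>w. complex_of_real (u w)) z = a"
proof -
  have "((\<lambda>w. complex_of_real (u w)) has_derivative (\<lambda>v. complex_of_real (2 * Re (a * v)))) (at z)"
    using assms by (rule has_derivative_of_real)
  from frechet_derivative_at[OF this, symmetric] show ?thesis
    by (simp add: dz_def complex_eq_iff)
qed

lemma jacobian_has_derivative:
  assumes S: "open S" "h holomorphic_on S" "g holomorphic_on S"
    and f: "\<And>z. z \<in> S \<Longrightarrow> f z = h z + cnj (g z)" and z: "z \<in> S"
  shows "(jacobian f has_derivative
           (\<lambda>v. 2 * Re ((deriv (deriv h) z * cnj (deriv h z) - deriv (deriv g) z * cnj (deriv g z)) * v)))
         (at z)"
proof -
  have *: "(deriv k has_field_derivative deriv (deriv k) z) (at z)" if "k holomorphic_on S" for k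
    using that S(1) z by (meson holomorphic_deriv holomorphic_derivI)
  have "((\<lambda>w. (cmod (deriv h w))\<^sup>2 - (cmod (deriv g w))\<^sup>2) has_derivative
           (\<lambda>v. 2 * Re (deriv (deriv h) z * cnj (deriv h z) * v)
              - 2 * Re (deriv (deriv g) z * cnj (deriv g z) * v))) (at z)"
    by (rule has_derivative_diff[OF has_derivative_norm_square_holomorphic[OF *[OF S(2)]]
          has_derivative_norm_square_holomorphic[OF *[OF S(3)]]])
  then have "((\<lambda>w. (cmod (deriv h w))\<^sup>2 - (cmod (deriv g w))\<^sup>2) has_derivative
           (\<lambda>v. 2 * Re ((deriv (deriv h) z * cnj (deriv h z) - deriv (deriv g) z * cnj (deriv g z)) * v)))
         (at z)"
    by (simp add: algebra_simps)
  then show ?thesis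
    by (rule has_derivative_transform_within_open[OF _ S(1) z])
      (simp add: jacobian_decomposition[OF S f])
qed

text \<open>Eliminates \<open>h\<close> and \<open>g\<close>: the coefficient
  \<open>h'' * cnj h' - g'' * cnj g'\<close> is recognised as the numerator of the pre-Schwarzian
  derivative, the only quantity that the norm controls.\<close>

lemma harmonic_jacobian_has_derivative:
  assumes "harmonic_mapping_on (ball 0 1) f" "z \<in> ball 0 1"
  shows "(jacobian f has_derivative
           (\<lambda>v. 2 * Re (dz (\<lambda>w. complex_of_real (jacobian f w)) z * v))) (at z)"
proof -
  obtain h g where hg: "h holomorphic_on ball 0 1" "g holomorphic_on ball 0 1"
    "\<And>z. z \<in> ball 0 1 \<Longrightarrow> f z = h z + cnj (g z)"
    using harmonic_mapping_obtains_decomposition[OF assms(1)] by metis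
  have J: "(jacobian f has_derivative
      (\<lambda>v. 2 * Re ((deriv (deriv h) z * cnj (deriv h z) - deriv (deriv g) z * cnj (deriv g z)) * v)))
      (at z)"
    by (rule jacobian_has_derivative[OF open_ball hg assms(2)])
  then show ?thesis
    unfolding dz_of_real[OF J] .
qed

section \<open>Growth of the Jacobian along radii and the inclusion\<close>

lemma gronwall_hyperbolic:
  fixes u :: "real \<Rightarrow> real"
  assumes r: "0 \<le> r" "r < 1"
    and u: "\<And>t. 0 \<le> t \<Longrightarrow> t \<le> r \<Longrightarrow> (u has_real_derivative u' t) (at t)"
    and le: "\<And>t. 0 \<le> t \<Longrightarrow> t \<le> r \<Longrightarrow> u t \<noteq> 0 \<Longrightarrow> (1 - t\<^sup>2) * \<bar>u' t\<bar> \<le> 2 * \<nu> * \<bar>u t\<bar>"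
  shows "\<bar>u r\<bar> * (1 - r) powr \<nu> \<le> \<bar>u 0\<bar> * (1 + r) powr \<nu>"
proof -
  \<comment> \<open>The integrating factor has logarithmic derivative -4\<nu>/(1 - t^2), which
    offsets the largest possible growth rate of \<open>(u t)\<^sup>2\<close>, since
    \<bar>2u'/u\<bar> \<le> 4\<nu>/(1 - t^2) wherever u is nonzero.\<close>
  define E where "E t = exp (2 * \<nu> * (ln (1 - t) - ln (1 + t)))" for t :: real
  have "(u r)\<^sup>2 * E r \<le> (u 0)\<^sup>2 * E 0"
  proof (rule DERIV_nonpos_imp_nonincreasing[OF r(1)])
    fix t assume t: "0 \<le> t" "t \<le> r"
    then have t2: "1 - t\<^sup>2 > 0"
      using r by (simp add: power_less_one_iff abs_square_less_1)
    have "(E has_real_derivative E t * (2 * \<nu> * (- 1 / (1 - t) - 1 / (1 + t)))) (at t)"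
      unfolding E_def using t r by (auto intro!: derivative_eq_intros simp: field_simps)
    then have "((\<lambda>t. (u t)\<^sup>2 * E t) has_real_derivative
        2 * u t * u' t * E t + (E t * (2 * \<nu> * (- 1 / (1 - t) - 1 / (1 + t)))) * (u t)\<^sup>2) (at t)"
      using u[OF t] by (auto intro!: derivative_eq_intros)
    moreover have "2 * u t * u' t * E t + (E t * (2 * \<nu> * (- 1 / (1 - t) - 1 / (1 + t)))) * (u t)\<^sup>2
      = 2 * E t * (u t * u' t - 2 * \<nu> * (u t)\<^sup>2 / (1 - t\<^sup>2))"
    proof -
      have eq: "- 1 / (1 - t) - 1 / (1 + t) = - 2 / (1 - t\<^sup>2)"
        using t r t2 by (simp add: divide_simps) (simp add: power2_eq_square algebra_simps)
      show ?thesis unfolding eq by (simp add: algebra_simps)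
    qed
    moreover have "u t * u' t \<le> 2 * \<nu> * (u t)\<^sup>2 / (1 - t\<^sup>2)"
    \<comment> \<open>Squaring \<open>u\<close> pays off here: at a zero both sides vanish, so no
      bound on \<open>u'\<close> is required there.\<close>
    proof (cases "u t = 0")
      case False
      have "\<bar>u' t\<bar> \<le> 2 * \<nu> * \<bar>u t\<bar> / (1 - t\<^sup>2)"
        using le[OF t False] t2 by (simp add: pos_le_divide_eq mult.commute)
      then have "\<bar>u t\<bar> * \<bar>u' t\<bar> \<le> \<bar>u t\<bar> * (2 * \<nu> * \<bar>u t\<bar> / (1 - t\<^sup>2))"
        by (rule mult_left_mono) simp
      also have "\<dots> = 2 * \<nu> * (u t)\<^sup>2 / (1 - t\<^sup>2)"
        by (simp add: power2_eq_square)
      finally show ?thesis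
        by (metis abs_ge_self abs_mult order_trans)
    qed simp
    moreover have "E t > 0" by (simp add: E_def)
    ultimately show "\<exists>y. ((\<lambda>t. (u t)\<^sup>2 * E t) has_real_derivative y) (at t) \<and> y \<le> 0"
      by (intro exI[of _ "2 * E t * (u t * u' t - 2 * \<nu> * (u t)\<^sup>2 / (1 - t\<^sup>2))"])
        (simp add: mult_nonneg_nonpos)
  qed
  moreover have "E 0 = 1" by (simp add: E_def)
  moreover have "E r = ((1 - r) powr \<nu> / (1 + r) powr \<nu>)\<^sup>2"
    using r by (simp add: E_def powr_def flip: exp_diff exp_double) (simp add: algebra_simps)
  ultimately have "(\<bar>u r\<bar> * ((1 - r) powr \<nu> / (1 + r) powr \<nu>))\<^sup>2 \<le> \<bar>u 0\<bar>\<^sup>2"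
    by (simp add: power_mult_distrib del: times_divide_eq_right)
  then have "\<bar>u r\<bar> * ((1 - r) powr \<nu> / (1 + r) powr \<nu>) \<le> \<bar>u 0\<bar>"
    by (rule power2_le_imp_le) simp
  then show ?thesis
    using r by (simp add: divide_simps split: if_splits)
qed

lemma pre_schwarzian_norm_le_iff:
  "pre_schwarzian_norm f \<le> ereal \<nu> \<longleftrightarrow>
     (\<forall>z\<in>ball 0 1. (1 - (cmod z)\<^sup>2) * cmod (pre_schwarzian f z) \<le> \<nu>)"
  by (simp add: pre_schwarzian_norm_def SUP_le_iff)

text \<open>Clears the denominator of the pre-Schwarzian derivative. At a zero of the Jacobian the
  quotient is 0 by convention and says nothing about its numerator, hence the assumption
  \<open>J\<close>.\<close>

lemma dz_jacobian_bound:
  assumes f: "harmonic_mapping_on (ball 0 1) f" "pre_schwarzian_norm f \<le> ereal \<nu>"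
    and J: "jacobian f z \<noteq> 0" and z: "z \<in> ball 0 1"
  shows "(1 - (cmod z)\<^sup>2) * cmod (dz (\<lambda>w. complex_of_real (jacobian f w)) z) \<le> \<nu> * \<bar>jacobian f z\<bar>"
proof -
  have "(1 - (cmod z)\<^sup>2) * cmod (pre_schwarzian f z) \<le> \<nu>"
    using f(2) z by (simp add: pre_schwarzian_norm_le_iff)
  then show ?thesis
    using J by (simp add: pre_schwarzian_def norm_divide pos_divide_le_eq)
qed

lemma jacobian_growth:
  assumes f: "harmonic_mapping_on (ball 0 1) f" "pre_schwarzian_norm f \<le> ereal \<nu>"
    and z: "z \<in> ball 0 1"
  shows "\<bar>jacobian f z\<bar> * (1 - cmod z) powr \<nu> \<le> \<bar>jacobian f 0\<bar> * (1 + cmod z) powr \<nu>"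
proof -
  define a where "a w = dz (\<lambda>w. complex_of_real (jacobian f w)) w" for w
  \<comment> \<open>The direction of the radius. As \<open>sgn 0 = 0\<close>, its modulus is only
    bounded by 1; this treats z = 0 without a case split.\<close>
  define \<zeta> where "\<zeta> = sgn z"
  have \<zeta>: "cmod \<zeta> \<le> 1" "complex_of_real (cmod z) * \<zeta> = z"
    by (simp_all add: \<zeta>_def norm_sgn) (simp add: sgn_eq)
  have path: "cmod (t * \<zeta>) \<le> t" "t * \<zeta> \<in> ball 0 1" if "0 \<le> t" "t \<le> cmod z" for t :: real
  proof -
    show "cmod (t * \<zeta>) \<le> t"
      using that \<zeta>(1) by (simp add: norm_mult mult_left_le)
    then show "t * \<zeta> \<in> ball 0 1" using that z by simp
  qed
  have "\<bar>jacobian f (cmod z * \<zeta>)\<bar> * (1 - cmod z) powr \<nu>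
      \<le> \<bar>jacobian f (complex_of_real 0 * \<zeta>)\<bar> * (1 + cmod z) powr \<nu>"
  proof (rule gronwall_hyperbolic[where u = "\<lambda>t. jacobian f (complex_of_real t * \<zeta>)"
        and u' = "\<lambda>t. 2 * Re (a (complex_of_real t * \<zeta>) * \<zeta>)"])
    fix t :: real assume t: "0 \<le> t" "t \<le> cmod z"
    have "((\<lambda>t. complex_of_real t * \<zeta>) has_derivative (\<lambda>s. complex_of_real s * \<zeta>)) (at t)"
      by (auto intro!: derivative_eq_intros)
    from has_derivative_compose[OF this harmonic_jacobian_has_derivative[OF f(1) path(2)[OF t]]]
    show "((\<lambda>t. jacobian f (complex_of_real t * \<zeta>)) has_real_derivative
        2 * Re (a (complex_of_real t * \<zeta>) * \<zeta>)) (at t)"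
      unfolding has_field_derivative_def a_def
      by (rule has_derivative_eq_rhs) (auto simp: algebra_simps)
    assume J: "jacobian f (t * \<zeta>) \<noteq> 0"
    let ?w = "complex_of_real t * \<zeta>"
    have "\<bar>Re (a ?w * \<zeta>)\<bar> \<le> cmod (a ?w * \<zeta>)"
      by (rule abs_Re_le_cmod)
    also have "\<dots> \<le> cmod (a ?w)"
      using \<zeta>(1) by (simp add: norm_mult mult_left_le)
    \<comment> \<open>Since \<open>cmod ?w \<le> t\<close>, the weight at \<open>?w\<close> is at
      least 1 - t^2.\<close>
    finally have "(1 - t\<^sup>2) * \<bar>Re (a ?w * \<zeta>)\<bar> \<le> (1 - (cmod ?w)\<^sup>2) * cmod (a ?w)"
      using path[OF t] t z
      by (intro mult_mono diff_left_mono power_mono)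
        (auto simp: abs_square_le_1 power_le_one)
    also have "\<dots> \<le> \<nu> * \<bar>jacobian f ?w\<bar>"
      unfolding a_def by (rule dz_jacobian_bound[OF f J path(2)[OF t]])
    finally show "(1 - t\<^sup>2) * \<bar>2 * Re (a ?w * \<zeta>)\<bar> \<le> 2 * \<nu> * \<bar>jacobian f ?w\<bar>"
      by (simp add: abs_mult del: times_complex.sel)
  qed (use z in auto)
  then show ?thesis by (simp add: \<zeta>(2))
qed

text \<open>Multiplying the growth bound by (1 + r)^\<nu> completes (1 - r)^\<nu> to (1 - r^2)^\<nu>
  and leaves (1 + r)^(2\<nu>) \<le> 4^\<nu> on the right. Taking square roots halves the
  exponent.\<close>

lemma B_H_subset_Bloch_star_H:
  assumes "\<nu> > 0"
  shows "B_H \<nu> \<subseteq> Bloch_star_H (\<nu> / 2)"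
proof
  fix f assume f: "f \<in> B_H \<nu>"
  have "(1 - (cmod z)\<^sup>2) powr (\<nu> / 2) * sqrt \<bar>jacobian f z\<bar> \<le> sqrt (\<bar>jacobian f 0\<bar> * 4 powr \<nu>)"
    if z: "z \<in> ball 0 1" for z
  proof -
    define r where "r = cmod z"
    have r: "0 \<le> r" "r < 1" using z by (auto simp: r_def)
    have r2: "1 - r\<^sup>2 = (1 - r) * (1 + r)" by (simp add: power2_eq_square algebra_simps)
    have "\<bar>jacobian f z\<bar> * (1 - r\<^sup>2) powr \<nu> = \<bar>jacobian f z\<bar> * (1 - r) powr \<nu> * (1 + r) powr \<nu>"
      unfolding r2 using r by (simp add: powr_mult)
    also have "\<dots> \<le> \<bar>jacobian f 0\<bar> * (1 + r) powr \<nu> * (1 + r) powr \<nu>"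
      unfolding r_def using f z assms
      by (intro mult_right_mono jacobian_growth) (auto simp: B_H_def)
    also have "\<dots> = \<bar>jacobian f 0\<bar> * ((1 + r) * (1 + r)) powr \<nu>"
      using r by (simp add: powr_mult)
    also have "\<dots> \<le> \<bar>jacobian f 0\<bar> * 4 powr \<nu>"
      using r assms mult_mono[of "1 + r" 2 "1 + r" 2]
      by (intro mult_left_mono powr_mono2) auto
    finally have "sqrt (\<bar>jacobian f z\<bar> * (1 - r\<^sup>2) powr \<nu>) \<le> sqrt (\<bar>jacobian f 0\<bar> * 4 powr \<nu>)"
      by simp
    moreover have "sqrt ((1 - r\<^sup>2) powr \<nu>) = (1 - r\<^sup>2) powr (\<nu> / 2)"
      by (rule real_sqrt_unique) (simp_all add: power2_eq_square flip: powr_add)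
    ultimately show ?thesis
      by (simp add: real_sqrt_mult r_def mult.commute)
  qed
  then have "bdd_above ((\<lambda>z. (1 - (cmod z)\<^sup>2) powr (\<nu> / 2) * sqrt \<bar>jacobian f z\<bar>) ` ball 0 1)"
    by (rule bdd_aboveI2)
  with f show "f \<in> Bloch_star_H (\<nu> / 2)"
    by (simp add: B_H_def Bloch_star_H_def)
qed

section \<open>Specialisation to analytic functions\<close>

lemma jacobian_holomorphic:
  assumes "f holomorphic_on S" "open S" "z \<in> S"
  shows "jacobian f z = (cmod (deriv f z))\<^sup>2"
  using jacobian_decomposition[of S f "\<lambda>_. 0" f z] assms by simp

text \<open>For analytic \<open>f\<close> the root of the Jacobian is
  \<open>cmod (deriv f z)\<close>. This carries both the inclusion and its sharpness between the
  harmonic and the analytic classes.\<close>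

lemma Bloch_iff_Bloch_star_H:
  assumes "f holomorphic_on ball 0 1"
  shows "f \<in> Bloch \<nu> \<longleftrightarrow> f \<in> Bloch_star_H \<nu>"
proof -
  have "harmonic_mapping_on (ball 0 1) f"
    by (rule harmonic_mapping_on_decomposition[of _ f "\<lambda>_. 0"]) (use assms in auto)
  moreover have "(\<lambda>z. (1 - (cmod z)\<^sup>2) powr \<nu> * sqrt \<bar>jacobian f z\<bar>) ` ball 0 1
      = (\<lambda>z. (1 - (cmod z)\<^sup>2) powr \<nu> * cmod (deriv f z)) ` ball 0 1"
    by (intro image_cong) (simp_all add: jacobian_holomorphic[OF assms])
  ultimately show ?thesis
    using assms by (simp add: Bloch_def Bloch_star_H_def)
qed

text \<open>The factor \<open>cnj (deriv f z)\<close> cancels. Where \<open>deriv f z = 0\<close>,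
  both quotients are 0 by convention.\<close>

lemma pre_schwarzian_holomorphic:
  assumes "f holomorphic_on S" "open S" "z \<in> S"
  shows "pre_schwarzian f z = deriv (deriv f) z / deriv f z"
proof -
  have "dz (\<lambda>w. complex_of_real (jacobian f w)) z = deriv (deriv f) z * cnj (deriv f z)"
    by (rule dz_of_real) (use jacobian_has_derivative[of S f "\<lambda>_. 0" f z] assms in simp)
  then show ?thesis
    by (simp add: pre_schwarzian_def jacobian_holomorphic[OF assms] complex_norm_square
        del: of_real_power)
qed

lemma locally_univalent_onI:
  assumes "f holomorphic_on S" "open S" "\<And>z. z \<in> S \<Longrightarrow> deriv f z \<noteq> 0"
  shows "locally_univalent_on S f"
  unfolding locally_univalent_on_def
  using has_complex_derivative_locally_injective[OF assms(1) _ assms(2)] assms(3) by metis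

section \<open>Sharpness of the exponent\<close>

lemma extremal_function_exists:
  fixes \<nu> :: real
  assumes "\<nu> > 0"
  obtains f where "f \<in> B_A \<nu>"
    and "\<And>x. 0 \<le> x \<Longrightarrow> x < 1 \<Longrightarrow> cmod (deriv f (complex_of_real x)) = (1 - x) powr (- \<nu> / 2)"
proof -
  \<comment> \<open>The principal branch of (1 - z)^(-\<nu>/2), analytic because 1 - z has positive
    real part in the disk.\<close>
  define p where "p z = exp (complex_of_real (- \<nu> / 2) * Ln (1 - z))" for z
  have slit: "1 - (z::complex) \<notin> \<real>\<^sub>\<le>\<^sub>0" "1 - z \<noteq> 0" if "z \<in> ball 0 1" for z
    using that abs_Re_le_cmod[of z] by (auto simp: complex_nonpos_Reals_iff)
  have p: "(p has_field_derivative complex_of_real (\<nu> / 2) / (1 - z) * p z) (at z)"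
    if "z \<in> ball 0 1" for z
    unfolding p_def using slit[OF that]
    by (auto intro!: derivative_eq_intros simp: field_simps)
  then have "p holomorphic_on ball 0 1"
    using holomorphic_on_open open_ball by blast
  then obtain f where f: "\<And>z. z \<in> ball 0 1 \<Longrightarrow> (f has_field_derivative p z) (at z)"
    using holomorphic_convex_primitive'[of "ball 0 1" p] by (auto simp: at_within_open_NO_MATCH)
  have hol: "f holomorphic_on ball 0 1"
    using f holomorphic_on_open open_ball by blast
  have f': "deriv f z = p z" if "z \<in> ball 0 1" for z
    using f[OF that] by (rule DERIV_imp_deriv)
  have p0: "p z \<noteq> 0" if "z \<in> ball 0 1" for z
    by (simp add: p_def)
  have f'': "deriv (deriv f) z = complex_of_real (\<nu> / 2) / (1 - z) * p z" if "z \<in> ball 0 1" for z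
    by (rule DERIV_imp_deriv, rule has_field_derivative_transform_within_open[OF p[OF that] open_ball that])
      (simp add: f')
  have "(1 - (cmod z)\<^sup>2) * cmod (pre_schwarzian f z) \<le> \<nu>" if z: "z \<in> ball 0 1" for z
  proof -
    have "1 - cmod z \<le> cmod (1 - z)" "cmod z < 1"
      using norm_triangle_ineq2[of 1 z] z by auto
    \<comment> \<open>The factor 2 cancels the one in \<nu>/(2(1 - z)), so the norm is at most
      \<nu>.\<close>
    then have "(1 - cmod z) * (1 + cmod z) \<le> cmod (1 - z) * 2"
      by (intro mult_mono) auto
    then have "(1 - (cmod z)\<^sup>2) * \<nu> \<le> cmod (1 - z) * 2 * \<nu>"
      using assms by (intro mult_right_mono) (auto simp: power2_eq_square algebra_simps)
    moreover have "pre_schwarzian f z = complex_of_real (\<nu> / 2) / (1 - z)"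
      using p0[OF z] by (simp only: pre_schwarzian_holomorphic[OF hol open_ball z] f''[OF z] f'[OF z]) simp
    then have "cmod (pre_schwarzian f z) = \<nu> / (2 * cmod (1 - z))"
      using assms by (simp add: norm_divide del: of_real_divide)
    ultimately show ?thesis
      using slit(2)[OF z] by (simp add: pos_divide_le_eq mult_ac)
  qed
  moreover have "harmonic_mapping_on (ball 0 1) f"
    by (rule harmonic_mapping_on_decomposition[of _ f "\<lambda>_. 0"]) (use hol in auto)
  moreover have "locally_univalent_on (ball 0 1) f"
    by (rule locally_univalent_onI[OF hol]) (use f' p0 in auto)
  ultimately have "f \<in> B_A \<nu>"
    using hol by (simp add: B_A_def B_H_def pre_schwarzian_norm_le_iff)
  moreover have "cmod (deriv f (complex_of_real x)) = (1 - x) powr (- \<nu> / 2)"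
    if "0 \<le> x" "x < 1" for x
  proof -
    have "p (complex_of_real x) = exp (complex_of_real (- \<nu> / 2) * complex_of_real (ln (1 - x)))"
      using that by (simp add: p_def flip: Ln_of_real)
    then have "cmod (p (complex_of_real x)) = (1 - x) powr (- \<nu> / 2)"
      using that by (simp add: powr_def)
    then show ?thesis
      using that f'[of x] by simp
  qed
  ultimately show thesis using that by blast
qed

text \<open>At the point 1 - s of the real radius the weighted derivative of the extremal function
  is at least s^(\<epsilon> - \<nu>/2), which is unbounded as s tends to 0.\<close>

lemma B_A_not_subset_Bloch:
  assumes "0 < \<epsilon>" "\<epsilon> < \<nu> / 2"
  shows "\<not> B_A \<nu> \<subseteq> Bloch \<epsilon>"
proof
  assume sub: "B_A \<nu> \<subseteq> Bloch \<epsilon>"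
  obtain f where f: "f \<in> B_A \<nu>"
    and f': "\<And>x. 0 \<le> x \<Longrightarrow> x < 1 \<Longrightarrow> cmod (deriv f (complex_of_real x)) = (1 - x) powr (- \<nu> / 2)"
    using extremal_function_exists[of \<nu>] assms by auto
  then obtain C where C: "\<And>z. z \<in> ball 0 1 \<Longrightarrow> (1 - (cmod z)\<^sup>2) powr \<epsilon> * cmod (deriv f z) \<le> C"
    using sub by (fastforce simp: Bloch_def bdd_above_def)
  define \<delta> where "\<delta> = \<nu> / 2 - \<epsilon>"
  \<comment> \<open>Chosen so that \<open>s powr - \<delta>\<close> equals \<bar>C\<bar> + 2, which
    exceeds C; the summand 2 makes the base larger than 1, so that s < 1.\<close>
  define s where "s = (\<bar>C\<bar> + 2) powr (- 1 / \<delta>)"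
  have \<delta>: "\<delta> > 0" using assms by (simp add: \<delta>_def)
  have s: "0 < s" "s < 1"
    using \<delta> powr_less_mono[of "- 1 / \<delta>" 0 "\<bar>C\<bar> + 2"] by (auto simp: s_def)
  have "\<bar>C\<bar> + 2 = s powr - \<delta>"
    using \<delta> by (simp add: s_def powr_powr)
  also have "\<dots> = s powr \<epsilon> * s powr (- \<nu> / 2)"
    by (simp add: \<delta>_def flip: powr_add)
  \<comment> \<open>Uses 1 - (1 - s)^2 = s(2 - s) \<ge> s.\<close>
  also have "\<dots> \<le> (1 - (1 - s)\<^sup>2) powr \<epsilon> * s powr (- \<nu> / 2)"
    using s assms by (intro mult_right_mono powr_mono2) (auto simp: power2_eq_square algebra_simps)
  also have "\<dots> \<le> C"
    using C[of "complex_of_real (1 - s)"] f'[of "1 - s"] s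
    by (simp only: norm_of_real mem_ball_0 abs_of_pos) simp
  finally show False by simp
qed

section \<open>Strictness of the inclusions and conclusion\<close>

lemma constant_in_Bloch: "(\<lambda>_. c) \<in> Bloch \<nu>"
  by (auto simp: Bloch_def intro: bdd_aboveI2[of _ _ 0])

text \<open>It is local univalence that excludes constants: their pre-Schwarzian derivative is 0/0 =
  0 by convention, so their norm is 0.\<close>

lemma constant_notin_B_H: "(\<lambda>_. c) \<notin> B_H \<nu>"
proof
  assume "(\<lambda>_. c) \<in> B_H \<nu>"
  then have "\<forall>z\<in>ball (0::complex) 1. \<exists>r>0. ball z r \<subseteq> ball 0 1 \<and> inj_on (\<lambda>_. c) (ball z r)"
    by (simp add: B_H_def locally_univalent_on_def)
  then obtain r where r: "r > 0" "inj_on (\<lambda>_. c) (ball (0::complex) r)"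
    by (metis centre_in_ball zero_less_one)
  have "complex_of_real (r / 2) = 0"
    by (rule inj_onD[OF r(2) refl]) (use r(1) in auto)
  with r(1) show False by simp
qed

theorem theorem2:
  fixes \<nu> :: real
  assumes "\<nu> > 0"
  shows "B_H \<nu> \<subset> Bloch_star_H (\<nu> / 2) \<and>
         B_A \<nu> \<subset> Bloch (\<nu> / 2) \<and>
         (\<forall>\<epsilon>. 0 < \<epsilon> \<and> \<epsilon> < \<nu> / 2 \<longrightarrow>
            \<not> B_H \<nu> \<subseteq> Bloch_star_H \<epsilon> \<and> \<not> B_A \<nu> \<subseteq> Bloch \<epsilon>)"
proof -
  have A: "B_A \<nu> \<subseteq> B_H \<nu>" "\<And>f. f \<in> B_A \<nu> \<Longrightarrow> f holomorphic_on ball 0 1"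
    by (auto simp: B_A_def)
  have "(\<lambda>_. 0) \<in> Bloch_star_H (\<nu> / 2)"
    using Bloch_iff_Bloch_star_H[of "\<lambda>_. 0"] constant_in_Bloch by simp
  then have 1: "B_H \<nu> \<subset> Bloch_star_H (\<nu> / 2)"
    using B_H_subset_Bloch_star_H[OF assms] constant_notin_B_H by blast
  then have "B_A \<nu> \<subseteq> Bloch (\<nu> / 2)"
    using A Bloch_iff_Bloch_star_H by blast
  then have 2: "B_A \<nu> \<subset> Bloch (\<nu> / 2)"
    using A(1) constant_in_Bloch constant_notin_B_H by blast
  have "\<not> B_A \<nu> \<subseteq> Bloch \<epsilon>" "\<not> B_H \<nu> \<subseteq> Bloch_star_H \<epsilon>" if "0 < \<epsilon>" "\<epsilon> < \<nu> / 2" for \<epsilon>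
  proof -
    show "\<not> B_A \<nu> \<subseteq> Bloch \<epsilon>"
      by (rule B_A_not_subset_Bloch[OF that])
    \<comment> \<open>The analytic counterexample serves again: it lies in \<open>B_H \<nu>\<close>,
      and for analytic functions the two Bloch conditions agree.\<close>
    then show "\<not> B_H \<nu> \<subseteq> Bloch_star_H \<epsilon>"
      using A Bloch_iff_Bloch_star_H by blast
  qed
  with 1 2 show ?thesis by blast
qed

end
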